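(* Suppose $V$ is $\beta$-smooth ($\beta>0$), the step size satisfies $0<\eta\le1/\beta$, and the initial covariance satisfies $\Sigma_0\succeq\beta^{-1}I$. Then the covariances of the iterates of FB--GVI (or of Stochastic FB--GVI, almost surely) satisfy $\Sigma_k\succeq\beta^{-1}I$ for all $k\ge0$.
   Context: $V:\mathbb R^d\to\mathbb R$ is $\beta$-smooth if twice continuously differentiable with $-\beta I\preceq\nabla^2V(x)\preceq\beta I$ for all $x$. Algorithms with step size $\eta>0$, initialization $p_0=\mathcal N(m_0,\Sigma_0)$ with $\Sigma_0$ positive definite: given $p_k=\mathcal N(m_k,\Sigma_k)$, FB--GVI sets $b_k=\mathbb E_{p_k}\nabla V$, $S_k=\mathbb E_{p_k}\nabla^2V$; Stochastic FB--GVI draws $\hat X_k\sim p_k$ and sets $b_k=\nabla V(\hat X_k)$, $S_k=\nabla^2V(\hat X_k)$. Both set $m_{k+1}=m_k-\eta b_k$, $\Sigma_{k+1/2}=(I-\eta S_k)\Sigma_k(I-\eta S_k)$, $\Sigma_{k+1}=\tfrac12\big(\Sigma_{k+1/2}+2\eta I+[\Sigma_{k+1/2}(\Sigma_{k+1/2}+4\eta I)]^{1/2}\big)$ (principal PSD square root), $p_{k+1}=\mathcal N(m_{k+1},\Sigma_{k+1})$. *)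

theory Defs
  imports "HOL-Analysis.Analysis"
begin

type_synonym 'n mat = "real^'n^'n"

definition sym_mat :: "'n::finite mat \<Rightarrow> bool" where
  "sym_mat A \<longleftrightarrow> transpose A = A"

text \<open>Positive semidefinite (symmetric) matrices and the Loewner order.\<close>
definition psd :: "'n::finite mat \<Rightarrow> bool" where
  "psd A \<longleftrightarrow> sym_mat A \<and> (\<forall>v. 0 \<le> v \<bullet> (A *v v))"

definition pd :: "'n::finite mat \<Rightarrow> bool" where
  "pd A \<longleftrightarrow> sym_mat A \<and> (\<forall>v. v \<noteq> 0 \<longrightarrow> 0 < v \<bullet> (A *v v))"

definition loewner_le :: "'n::finite mat \<Rightarrow> 'n mat \<Rightarrow> bool" where
  "loewner_le A B \<longleftrightarrow> psd (B - A)"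

text \<open>Principal (PSD) square root of a PSD matrix.\<close>
definition psd_sqrt :: "'n::finite mat \<Rightarrow> 'n mat" where
  "psd_sqrt A = (THE B. psd B \<and> B ** B = A)"

text \<open>Density of the Gaussian N(m, Sigma) on R^n (Sigma positive definite).\<close>
definition gauss_density :: "real^'n::finite \<Rightarrow> 'n mat \<Rightarrow> real^'n \<Rightarrow> real" where
  "gauss_density m Sig x =
     exp (- ((x - m) \<bullet> (matrix_inv Sig *v (x - m))) / 2)
       / sqrt ((2 * pi) ^ CARD('n) * det Sig)"

text \<open>Expectation of f under N(m, Sigma).\<close>
definition gauss_expect ::
  "real^'n::finite \<Rightarrow> 'n mat \<Rightarrow> (real^'n \<Rightarrow> 'b::euclidean_space) \<Rightarrow> 'b" where
  "gauss_expect m Sig f = integral UNIV (\<lambda>x. gauss_density m Sig x *\<^sub>R f x)"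

text \<open>One forward-backward step, given b_k and S_k.\<close>
definition gvi_step ::
  "real \<Rightarrow> real^'n::finite \<Rightarrow> 'n mat \<Rightarrow> real^'n \<Rightarrow> 'n mat \<Rightarrow> (real^'n) \<times> ('n mat)" where
  "gvi_step \<eta> b S m Sig =
     (let Sh = (mat 1 - \<eta> *\<^sub>R S) ** Sig ** (mat 1 - \<eta> *\<^sub>R S)
      in (m - \<eta> *\<^sub>R b,
          (1/2) *\<^sub>R (Sh + (2 * \<eta>) *\<^sub>R mat 1 + psd_sqrt (Sh ** (Sh + (4 * \<eta>) *\<^sub>R mat 1)))))"

text \<open>FB--GVI iterates (m_k, Sigma_k); gradV is the gradient, H the Hessian of V.\<close>
primrec fbgvi ::
  "(real^'n::finite \<Rightarrow> real^'n) \<Rightarrow> (real^'n \<Rightarrow> 'n mat) \<Rightarrow> real \<Rightarrow> real^'n \<Rightarrow> 'n mat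
     \<Rightarrow> nat \<Rightarrow> (real^'n) \<times> ('n mat)" where
  "fbgvi gradV H \<eta> m0 S0 0 = (m0, S0)"
| "fbgvi gradV H \<eta> m0 S0 (Suc k) =
     (let (m, Sig) = fbgvi gradV H \<eta> m0 S0 k
      in gvi_step \<eta> (gauss_expect m Sig gradV) (gauss_expect m Sig H) m Sig)"

text \<open>Stochastic FB--GVI iterates along a realization X of the samples X_k.\<close>
primrec sfbgvi ::
  "(real^'n::finite \<Rightarrow> real^'n) \<Rightarrow> (real^'n \<Rightarrow> 'n mat) \<Rightarrow> real \<Rightarrow> real^'n \<Rightarrow> 'n mat
     \<Rightarrow> (nat \<Rightarrow> real^'n) \<Rightarrow> nat \<Rightarrow> (real^'n) \<times> ('n mat)" where
  "sfbgvi gradV H \<eta> m0 S0 X 0 = (m0, S0)"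
| "sfbgvi gradV H \<eta> m0 S0 X (Suc k) =
     (let (m, Sig) = sfbgvi gradV H \<eta> m0 S0 X k
      in gvi_step \<eta> (gradV (X k)) (H (X k)) m Sig)"

end

theory Submission
  imports Defs "HOL-Probability.Distributions"
begin

(* The covariance update is a forward step Sh = (I - eta S) Sig (I - eta S) followed by the
   backward (entropic proximal) step Sig' = (Sh + 2 eta I + (Sh (Sh + 4 eta I))^(1/2)) / 2.
   If S <= beta I and Sig >= I / beta, then I - eta S >= (1 - eta beta) I >= 0, so
   Sh >= (1 - eta beta)^2 / beta I.  Let u be a unit eigenvector of Sig' with eigenvalue sigma,
   s = u.Sh u and rho = 2 sigma - 2 eta.  The square root R satisfies R u = rho u - Sh u, and
   comparing |R u|^2 with u.R^2 u gives rho^2 - 2 rho s = 4 eta s with rho >= s.  The larger root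
   of this quadratic increases with s and equals 2 (1 - eta beta) / beta at
   s = (1 - eta beta)^2 / beta, hence sigma >= 1 / beta.
   For FB-GVI, S_k is an average of Hessians against a Gaussian density, which integrates to 1
   (diagonalise Sig and use rotation invariance of Lebesgue measure), so S_k <= beta I as well;
   for the stochastic version S_k is a Hessian.  Induction on k concludes. *)

section \<open>Symmetric matrices and the Loewner order\<close>

lemma sym_mat_iff_inner:
  fixes A :: "real^'n^'n"
  shows "sym_mat A \<longleftrightarrow> (\<forall>x y. x \<bullet> (A *v y) = (A *v x) \<bullet> y)"
proof
  assume "sym_mat A"
  then show "\<forall>x y. x \<bullet> (A *v y) = (A *v x) \<bullet> y"
    by (metis dot_lmul_matrix sym_mat_def transpose_matrix_vector)
next
  assume sym: "\<forall>x y. x \<bullet> (A *v y) = (A *v x) \<bullet> y"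
  have "transpose A *v x = A *v x" for x
  proof -
    have "(transpose A *v x - A *v x) \<bullet> y = 0" for y
      using sym dot_lmul_matrix[of x A y] by (simp add: inner_diff_left transpose_matrix_vector)
    from this[of "transpose A *v x - A *v x"] show ?thesis by simp
  qed
  then show "sym_mat A"
    by (simp add: sym_mat_def matrix_eq)
qed

lemma sym_mat_inner:
  fixes A :: "real^'n^'n"
  shows "sym_mat A \<Longrightarrow> x \<bullet> (A *v y) = (A *v x) \<bullet> y"
  by (simp add: sym_mat_iff_inner)

lemma sym_mat_diff: "sym_mat A \<Longrightarrow> sym_mat B \<Longrightarrow> sym_mat (A - B)"
  by (simp add: sym_mat_def transpose_def vec_eq_iff)

lemma sym_mat_scaled_id: "sym_mat (c *\<^sub>R mat 1)"
  by (simp add: sym_mat_def transpose_scalar)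

lemma sym_mat_add: "sym_mat A \<Longrightarrow> sym_mat B \<Longrightarrow> sym_mat (A + B)"
  by (simp add: sym_mat_def transpose_def vec_eq_iff)

lemma sym_mat_scaleR: "sym_mat A \<Longrightarrow> sym_mat (c *\<^sub>R A)"
  by (simp add: sym_mat_def transpose_scalar)

lemmas matrix_vector_mult_simps = matrix_vector_mul_assoc[symmetric] matrix_vector_mult_add_rdistrib
  matrix_vector_mult_diff_rdistrib scaleR_matrix_vector_assoc[symmetric] matrix_vector_mul_lid
  matrix_vector_right_distrib matrix_vector_mult_diff_distrib matrix_vector_mult_scaleR


lemma psd_scaled_id: "0 \<le> c \<Longrightarrow> psd (c *\<^sub>R mat 1 :: real^'n^'n)"
  by (simp add: psd_def sym_mat_scaled_id scaleR_matrix_vector_assoc[symmetric])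

lemma psd_mult_add_scaled_id:
  fixes A :: "real^'n^'n"
  assumes "psd A" "0 \<le> c"
  shows "psd (A ** (A + c *\<^sub>R mat 1))"
proof -
  have symA: "x \<bullet> (A *v y) = (A *v x) \<bullet> y" for x y
    using assms(1) by (simp add: psd_def sym_mat_inner)
  have Mx: "(A ** (A + c *\<^sub>R mat 1)) *v x = A *v (A *v x) + c *\<^sub>R (A *v x)" for x
    by (simp add: matrix_vector_mult_simps)
  show ?thesis
    unfolding psd_def sym_mat_iff_inner
  proof (intro conjI allI)
    show "x \<bullet> ((A ** (A + c *\<^sub>R mat 1)) *v y) = ((A ** (A + c *\<^sub>R mat 1)) *v x) \<bullet> y" for x y
      by (simp add: Mx inner_add_right inner_add_left symA)
    show "0 \<le> v \<bullet> ((A ** (A + c *\<^sub>R mat 1)) *v v)" for v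
    proof -
      have "v \<bullet> ((A ** (A + c *\<^sub>R mat 1)) *v v) = (A *v v) \<bullet> (A *v v) + c * (v \<bullet> (A *v v))"
        by (simp add: Mx inner_add_right symA[of v "A *v v"])
      then show ?thesis
        using assms by (simp add: psd_def)
    qed
  qed
qed

lemma scaled_id_loewner_le_iff:
  fixes A :: "real^'n^'n"
  shows "loewner_le (c *\<^sub>R mat 1) A \<longleftrightarrow> sym_mat A \<and> (\<forall>x. c * (x \<bullet> x) \<le> x \<bullet> (A *v x))"
  by (simp add: loewner_le_def psd_def sym_mat_iff_inner matrix_vector_mult_diff_rdistrib
      scaleR_matrix_vector_assoc[symmetric] inner_diff_left inner_diff_right inner_commute)

lemma loewner_le_scaled_id_iff:
  fixes A :: "real^'n^'n"
  shows "loewner_le A (c *\<^sub>R mat 1) \<longleftrightarrow> sym_mat A \<and> (\<forall>x. x \<bullet> (A *v x) \<le> c * (x \<bullet> x))"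
  by (simp add: loewner_le_def psd_def sym_mat_iff_inner matrix_vector_mult_diff_rdistrib
      scaleR_matrix_vector_assoc[symmetric] inner_diff_left inner_diff_right inner_commute)

lemma psd_if_scaled_id_loewner_le:
  fixes A :: "real^'n^'n"
  assumes "0 \<le> c" "loewner_le (c *\<^sub>R mat 1) A"
  shows "psd A"
  unfolding psd_def
proof (intro conjI allI)
  show "sym_mat A"
    using assms(2) by (simp add: scaled_id_loewner_le_iff)
  show "0 \<le> v \<bullet> (A *v v)" for v
  proof -
    have "0 \<le> c * (v \<bullet> v)"
      using assms(1) by simp
    also have "\<dots> \<le> v \<bullet> (A *v v)"
      using assms(2) by (simp add: scaled_id_loewner_le_iff)
    finally show ?thesis .
  qed
qed

lemma pd_if_scaled_id_loewner_le:
  fixes A :: "real^'n^'n"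
  assumes "0 < c" "loewner_le (c *\<^sub>R mat 1) A"
  shows "pd A"
  unfolding pd_def
proof (intro conjI allI impI)
  show "sym_mat A"
    using assms(2) by (simp add: scaled_id_loewner_le_iff)
  show "0 < v \<bullet> (A *v v)" if "v \<noteq> 0" for v
  proof -
    have "0 < c * (v \<bullet> v)"
      using assms(1) that by simp
    also have "\<dots> \<le> v \<bullet> (A *v v)"
      using assms(2) by (simp add: scaled_id_loewner_le_iff)
    finally show ?thesis .
  qed
qed

section \<open>Spectral theorem and square roots\<close>

lemma quadratic_nonneg_imp_linear_coeff_zero:
  fixes a b :: real
  assumes "\<And>t. 0 \<le> a * t + b * t^2" "0 \<le> b"
  shows "a = 0"
proof -
  have "0 \<le> a * (-a/(b+1)) + b * (-a/(b+1))^2" by (rule assms(1))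
  also have "\<dots> = -(a^2) / (b+1)^2"
    using assms(2) by (simp add: divide_simps power2_eq_square) (simp add: algebra_simps)
  finally have "a^2 \<le> 0"
    using assms(2) by (simp add: divide_le_0_iff)
  then show ?thesis by simp
qed

lemma rayleigh_minimiser_is_eigenvector:
  fixes A :: "real^'n^'n"
  assumes "sym_mat A" "subspace W" "\<And>w. w \<in> W \<Longrightarrow> A *v w \<in> W"
    and "v \<in> W" "v \<bullet> v = 1" "\<And>w. w \<in> W \<Longrightarrow> (v \<bullet> (A *v v)) * (w \<bullet> w) \<le> w \<bullet> (A *v w)"
  shows "A *v v = (v \<bullet> (A *v v)) *\<^sub>R v"
proof -
  define l where "l = v \<bullet> (A *v v)"
  define r where "r = A *v v - l *\<^sub>R v"
  have "r \<in> W"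
    unfolding r_def using assms(2,3,4) by (simp add: subspace_diff subspace_scale)
  \<comment> \<open>Perturbing v along r inside W cannot decrease the Rayleigh quotient, which forces r = 0.\<close>
  have "2 * (r \<bullet> r) = 0"
  proof (rule quadratic_nonneg_imp_linear_coeff_zero)
    fix t :: real
    have "v + t *\<^sub>R r \<in> W"
      using assms(2,4) \<open>r \<in> W\<close> by (simp add: subspace_add subspace_scale)
    then have "0 \<le> (v + t *\<^sub>R r) \<bullet> (A *v (v + t *\<^sub>R r)) - l * ((v + t *\<^sub>R r) \<bullet> (v + t *\<^sub>R r))"
      using assms(6) by (simp add: l_def)
    also have "\<dots> = 2 * (r \<bullet> r) * t + (r \<bullet> (A *v r) - l * (r \<bullet> r)) * t^2"
      using sym_mat_inner[OF assms(1), of v r] assms(5) unfolding r_def l_def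
      by (simp add: matrix_vector_right_distrib matrix_vector_mult_scaleR inner_add_left
          inner_add_right inner_diff_left inner_diff_right algebra_simps power2_eq_square
          inner_commute)
    finally show "0 \<le> 2 * (r \<bullet> r) * t + (r \<bullet> (A *v r) - l * (r \<bullet> r)) * t^2" .
  qed (use assms(6)[OF \<open>r \<in> W\<close>] in \<open>simp add: l_def\<close>)
  then show ?thesis
    by (simp add: r_def l_def)
qed

lemma sym_mat_invariant_subspace_has_eigenvector:
  fixes A :: "real^'n^'n"
  assumes "sym_mat A" "subspace W" "\<And>w. w \<in> W \<Longrightarrow> A *v w \<in> W" "w0 \<in> W" "w0 \<noteq> 0"
  obtains v l where "v \<in> W" "norm v = 1" "A *v v = l *\<^sub>R v"
proof -
  define K where "K = W \<inter> sphere 0 1"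
  have "compact K"
    unfolding K_def using assms(2)
    by (metis Int_commute closed_subspace closed_Int_compact compact_sphere)
  moreover have "w0 /\<^sub>R norm w0 \<in> K"
    using assms(2,4,5) by (simp add: K_def subspace_scale)
  ultimately obtain v where "v \<in> K" and vmin: "\<And>x. x \<in> K \<Longrightarrow> v \<bullet> (A *v v) \<le> x \<bullet> (A *v x)"
    using continuous_attains_inf[of K "\<lambda>x. x \<bullet> (A *v x)"] by (fastforce intro: continuous_intros)
  then have "v \<in> W" "norm v = 1"
    by (auto simp: K_def)
  have "(v \<bullet> (A *v v)) * (w \<bullet> w) \<le> w \<bullet> (A *v w)" if "w \<in> W" for w
  proof (cases "w = 0")
    case False
    have "w /\<^sub>R norm w \<in> K"
      using that False assms(2) by (simp add: K_def subspace_scale)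
    then have "v \<bullet> (A *v v) \<le> (w /\<^sub>R norm w) \<bullet> (A *v (w /\<^sub>R norm w))"
      by (rule vmin)
    also have "\<dots> = (w \<bullet> (A *v w)) / (norm w)^2"
      by (simp add: matrix_vector_mult_scaleR power2_eq_square inner_commute divide_inverse)
    finally show ?thesis
      using False by (simp add: pos_le_divide_eq dot_square_norm)
  qed simp
  then have "A *v v = (v \<bullet> (A *v v)) *\<^sub>R v"
    using \<open>norm v = 1\<close> by (intro rayleigh_minimiser_is_eigenvector[OF assms(1-3) \<open>v \<in> W\<close>])
      (simp_all add: dot_square_norm)
  with \<open>v \<in> W\<close> \<open>norm v = 1\<close> that show ?thesis
    by blast
qed

lemma sym_mat_orthonormal_eigenvectors:
  fixes A :: "real^'n^'n"
  assumes "sym_mat A"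
  shows "k \<le> CARD('n) \<Longrightarrow> \<exists>B. finite B \<and> card B = k \<and> pairwise orthogonal B \<and>
            (\<forall>b\<in>B. norm b = 1 \<and> (\<exists>l. A *v b = l *\<^sub>R b))"
proof (induction k)
  case (Suc k)
  then obtain B where B: "finite B" "card B = k" "pairwise orthogonal B"
      "\<forall>b\<in>B. norm b = 1 \<and> (\<exists>l. A *v b = l *\<^sub>R b)" by auto
  define W where "W = {w. \<forall>b\<in>B. orthogonal b w}"
  have "dim B < DIM(real^'n)"
    using dim_le_card'[OF B(1)] B(2) Suc.prems by simp
  then obtain x where x: "x \<noteq> 0" "\<And>y. y \<in> span B \<Longrightarrow> orthogonal x y"
    using orthogonal_to_subspace_exists by blast
  have "x \<in> W" unfolding W_def using x(2) span_base orthogonal_commute by blast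
  have "subspace W" unfolding W_def subspace_def
    by (auto simp: orthogonal_clauses)
  have "A *v w \<in> W" if "w \<in> W" for w
  proof -
    have "b \<bullet> (A *v w) = 0" if "b \<in> B" for b
    proof -
      obtain l where "A *v b = l *\<^sub>R b" using B(4) \<open>b \<in> B\<close> by blast
      then have "b \<bullet> (A *v w) = l * (b \<bullet> w)"
        using sym_mat_inner[OF assms, of b w] by simp
      with \<open>w \<in> W\<close> \<open>b \<in> B\<close> show ?thesis by (simp add: W_def orthogonal_def)
    qed
    then show ?thesis by (simp add: W_def orthogonal_def)
  qed
  then obtain v l where v: "v \<in> W" "norm v = 1" "A *v v = l *\<^sub>R v"
    using sym_mat_invariant_subspace_has_eigenvector[OF assms \<open>subspace W\<close> _ \<open>x \<in> W\<close> x(1)] by blast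
  have "v \<notin> B"
    using v unfolding W_def by (auto simp: orthogonal_def)
  then show ?case
    using B v
    by (intro exI[of _ "insert v B"]) (auto simp: W_def pairwise_insert orthogonal_commute)
qed (auto intro: exI[of _ "{}"])

definition diag_mat :: "('n \<Rightarrow> real) \<Rightarrow> real^'n^'n" where
  "diag_mat d = (\<chi> i j. if i = j then d i else 0)"

lemma diag_mat_mult_vector: "diag_mat d *v x = (\<chi> i. d i * x $ i)"
  by (simp add: diag_mat_def matrix_vector_mult_def vec_eq_iff if_distrib[where f="\<lambda>a. a * _"]
      cong: if_cong)

lemma diag_mat_mult_diag_mat: "diag_mat d ** diag_mat e = diag_mat (\<lambda>i. d i * e i)"
  by (simp add: diag_mat_def matrix_matrix_mult_def vec_eq_iff if_distrib[where f="\<lambda>a. a * _"]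
      cong: if_cong)

lemma diag_mat_one: "diag_mat (\<lambda>_. 1) = mat 1"
  by (simp add: diag_mat_def mat_def)

lemma transpose_diag_mat: "transpose (diag_mat d) = diag_mat d"
  by (simp add: diag_mat_def transpose_def vec_eq_iff)

lemma column_mult_diag_mat: "column i (Q ** diag_mat d) = d i *\<^sub>R column i Q"
  by (simp add: diag_mat_def column_def matrix_matrix_mult_def vec_eq_iff
      if_distrib[where f="\<lambda>a. _ * a"] cong: if_cong)

lemma column_matrix_mult: "column i (A ** Q) = A *v column i Q"
  by (simp add: column_def matrix_matrix_mult_def matrix_vector_mult_def vec_eq_iff)

lemma matrix_eq_iff_columns: "A = B \<longleftrightarrow> (\<forall>i. column i A = column i B)"
  by (auto simp: column_def vec_eq_iff)

lemma eigen_columns_imp_decomposition: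
  fixes M Q :: "real^'n^'n"
  assumes "orthogonal_matrix Q" "\<And>i. M *v column i Q = c i *\<^sub>R column i Q"
  shows "M = Q ** diag_mat c ** transpose Q"
proof -
  have "column i (M ** Q) = column i (Q ** diag_mat c)" for i
    unfolding column_mult_diag_mat by (simp only: column_matrix_mult assms(2))
  then have MQ: "M ** Q = Q ** diag_mat c"
    by (simp add: matrix_eq_iff_columns)
  have "M = M ** (Q ** transpose Q)"
    using assms(1) by (simp add: orthogonal_matrix_def)
  also have "\<dots> = Q ** diag_mat c ** transpose Q"
    by (simp only: matrix_mul_assoc MQ)
  finally show ?thesis .
qed

lemma sym_mat_spectral_decomposition:
  fixes A :: "real^'n^'n"
  assumes "sym_mat A"
  obtains Q d where "orthogonal_matrix Q" "A = Q ** diag_mat d ** transpose Q"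
    "\<And>i. A *v column i Q = d i *\<^sub>R column i Q"
proof -
  obtain B where B: "finite B" "card B = CARD('n)" "pairwise orthogonal B"
      "\<forall>b\<in>B. norm b = 1 \<and> (\<exists>l. A *v b = l *\<^sub>R b)"
    using sym_mat_orthonormal_eigenvectors[OF assms order_refl] by blast
  have "\<exists>e :: 'n \<Rightarrow> real^'n. bij_betw e UNIV B"
    by (rule finite_same_card_bij) (simp_all add: B(1,2))
  then obtain e :: "'n \<Rightarrow> real^'n" where e: "bij_betw e UNIV B" ..
  define Q :: "real^'n^'n" where "Q = (\<chi> r c. e c $ r)"
  have col: "column c Q = e c" for c
    by (simp add: Q_def column_def vec_eq_iff)
  have eB: "e c \<in> B" for c
    using e by (auto simp: bij_betw_def)
  have "orthogonal_matrix Q"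
    unfolding orthogonal_matrix_orthonormal_columns col
  proof (intro conjI allI impI)
    show "norm (e i) = 1" for i
      using B(4) eB by blast
    show "orthogonal (e i) (e j)" if "i \<noteq> j" for i j
    proof -
      have "e i \<noteq> e j"
        using that e by (metis bij_betw_imp_inj_on injD)
      then show ?thesis
        using B(3) eB unfolding pairwise_def by blast
    qed
  qed
  have "\<forall>c. \<exists>l. A *v e c = l *\<^sub>R e c"
    using B(4) eB by blast
  then obtain d where d: "\<And>c. A *v e c = d c *\<^sub>R e c"
    by metis
  have "A = Q ** diag_mat d ** transpose Q"
    using \<open>orthogonal_matrix Q\<close> by (rule eigen_columns_imp_decomposition) (simp add: col d)
  moreover have "A *v column i Q = d i *\<^sub>R column i Q" for i
    by (simp add: col d)
  ultimately show ?thesis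
    using that[OF \<open>orthogonal_matrix Q\<close>] by blast
qed

lemma pd_spectral_decomposition:
  fixes A :: "real^'n^'n"
  assumes "pd A"
  obtains Q d where "orthogonal_matrix Q" "A = Q ** diag_mat d ** transpose Q" "\<And>i. 0 < d i"
proof -
  obtain Q d where Q: "orthogonal_matrix Q" "A = Q ** diag_mat d ** transpose Q"
    and eig: "\<And>i. A *v column i Q = d i *\<^sub>R column i Q"
    using sym_mat_spectral_decomposition assms by (metis pd_def)
  have "column i Q \<bullet> column i Q = 1" for i
    using Q(1) by (simp add: orthogonal_matrix_orthonormal_columns norm_eq_1)
  then have "0 < d i" for i
    using assms eig[of i] unfolding pd_def
    by (metis inner_scaleR_right inner_zero_left mult.right_neutral zero_neq_one)
  with Q that show ?thesis
    by blast
qed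

lemma sym_mat_spectral: "sym_mat (Q ** diag_mat d ** transpose Q)"
  by (simp add: sym_mat_def matrix_transpose_mul matrix_mul_assoc transpose_diag_mat)

lemma orthogonal_diag_mat_mult:
  fixes Q :: "real^'n^'n"
  assumes "orthogonal_matrix Q"
  shows "(Q ** diag_mat a ** transpose Q) ** (Q ** diag_mat b ** transpose Q)
           = Q ** diag_mat (\<lambda>i. a i * b i) ** transpose Q"
proof -
  have "(Q ** diag_mat a ** transpose Q) ** (Q ** diag_mat b ** transpose Q)
      = Q ** diag_mat a ** (transpose Q ** Q) ** diag_mat b ** transpose Q"
    by (simp only: matrix_mul_assoc)
  also have "\<dots> = Q ** (diag_mat a ** diag_mat b) ** transpose Q"
    using assms by (simp add: orthogonal_matrix_def matrix_mul_assoc)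
  finally show ?thesis
    by (simp only: diag_mat_mult_diag_mat)
qed

lemma quadratic_form_spectral:
  fixes Q :: "real^'n^'n"
  shows "x \<bullet> ((Q ** diag_mat d ** transpose Q) *v x) = (\<Sum>i\<in>UNIV. d i * ((transpose Q *v x) $ i)^2)"
proof -
  have "x \<bullet> ((Q ** diag_mat d ** transpose Q) *v x)
      = (transpose Q *v x) \<bullet> (diag_mat d *v (transpose Q *v x))"
    by (simp add: matrix_vector_mul_assoc[symmetric] dot_lmul_matrix[symmetric]
        transpose_matrix_vector)
  then show ?thesis
    by (simp add: diag_mat_mult_vector inner_vec_def power2_eq_square mult_ac)
qed

lemma psd_if_eigenvalues_nonneg:
  fixes A :: "real^'n^'n"
  assumes "sym_mat A" "\<And>v l. v \<noteq> 0 \<Longrightarrow> A *v v = l *\<^sub>R v \<Longrightarrow> 0 \<le> l"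
  shows "psd A"
proof -
  obtain Q d where Q: "orthogonal_matrix Q" "A = Q ** diag_mat d ** transpose Q"
    and eig: "\<And>i. A *v column i Q = d i *\<^sub>R column i Q"
    using sym_mat_spectral_decomposition[OF assms(1)] by blast
  have "column i Q \<noteq> 0" for i
    using Q(1) unfolding orthogonal_matrix_orthonormal_columns by (metis norm_zero zero_neq_one)
  then have "0 \<le> d i" for i
    using assms(2) eig by blast
  then have "0 \<le> x \<bullet> (A *v x)" for x
    unfolding Q(2) quadratic_form_spectral by (simp add: sum_nonneg)
  then show ?thesis
    using assms(1) by (simp add: psd_def)
qed

lemma psd_eigenvector_of_square:
  fixes R :: "real^'n^'n"
  assumes "psd R" "(R ** R) *v v = \<mu> *\<^sub>R v" "0 \<le> \<mu>"
  shows "R *v v = sqrt \<mu> *\<^sub>R v"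
proof -
  have symR: "sym_mat R" and posR: "\<And>x. 0 \<le> x \<bullet> (R *v x)"
    using assms(1) by (auto simp: psd_def)
  \<comment> \<open>w is a (-s)-eigenvector of R, which positivity of R rules out unless w = 0 or s = 0.\<close>
  define s where "s = sqrt \<mu>"
  define w where "w = R *v v - s *\<^sub>R v"
  have "R *v w + s *\<^sub>R w = (R ** R) *v v - (s * s) *\<^sub>R v"
    by (simp add: w_def matrix_vector_right_distrib matrix_vector_mult_diff_distrib
        matrix_vector_mult_scaleR matrix_vector_mul_assoc algebra_simps)
  also have "\<dots> = 0"
    using assms(2,3) by (simp add: s_def)
  finally have "w \<bullet> (R *v w) = - s * (w \<bullet> w)"
    by (simp add: eq_neg_iff_add_eq_0[symmetric])
  then have sw: "s * (w \<bullet> w) \<le> 0"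
    using posR[of w] by linarith
  show ?thesis
  proof (cases "s = 0")
    case True
    then have "(R *v v) \<bullet> (R *v v) = 0"
      using assms(2,3) sym_mat_inner[OF symR, of v "R *v v"]
      by (simp add: s_def matrix_vector_mul_assoc)
    with True show ?thesis by (simp add: s_def)
  next
    case False
    then have "w \<bullet> w \<le> 0"
      using sw assms(3) by (simp add: s_def mult_le_0_iff)
    then have "w = 0"
      by (metis inner_eq_zero_iff inner_ge_zero order_antisym)
    then show ?thesis
      by (simp add: w_def s_def)
  qed
qed

lemma psd_sqrt_ex1:
  fixes A :: "real^'n^'n"
  assumes "psd A"
  shows "\<exists>!R. psd R \<and> R ** R = A"
proof -
  obtain Q d where Q: "orthogonal_matrix Q" "A = Q ** diag_mat d ** transpose Q"
    and eig: "\<And>i. A *v column i Q = d i *\<^sub>R column i Q"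
    using sym_mat_spectral_decomposition assms by (metis psd_def)
  have "column i Q \<bullet> column i Q = 1" for i
    using Q(1) by (simp add: orthogonal_matrix_orthonormal_columns norm_eq_1)
  then have d0: "0 \<le> d i" for i
    using assms eig[of i] by (metis psd_def inner_scaleR_right mult.right_neutral)
  define R where "R = Q ** diag_mat (\<lambda>i. sqrt (d i)) ** transpose Q"
  have "psd R"
    unfolding psd_def R_def quadratic_form_spectral by (simp add: sym_mat_spectral sum_nonneg d0)
  moreover have "(\<lambda>i. sqrt (d i) * sqrt (d i)) = d"
    using d0 by (simp add: fun_eq_iff)
  then have "R ** R = A"
    by (simp only: R_def orthogonal_diag_mat_mult[OF Q(1)] Q(2))
  moreover have "R' = R" if "psd R'" "R' ** R' = A" for R'
    unfolding R_def using Q(1)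
    by (rule eigen_columns_imp_decomposition) (use psd_eigenvector_of_square that eig d0 in metis)
  ultimately show ?thesis by blast
qed

lemma psd_sqrt:
  assumes "psd A"
  shows "psd (psd_sqrt A)" "psd_sqrt A ** psd_sqrt A = A"
  using theI'[OF psd_sqrt_ex1[OF assms]] unfolding psd_sqrt_def by auto

section \<open>Orthogonal invariance of Lebesgue measure\<close>

lemma prod_Basis_vec: "(\<Prod>b\<in>(Basis :: (real^'n) set). f b) = (\<Prod>i\<in>UNIV. f (axis i 1))"
proof -
  have B: "(Basis :: (real^'n) set) = range (\<lambda>i. axis i 1)"
    by (auto simp: Basis_vec_def)
  have "inj (\<lambda>i::'n. axis i (1::real))"
    by (auto intro: injI simp: axis_eq_axis)
  then show ?thesis
    unfolding B by (simp add: prod.reindex)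
qed

lemma linear_borel_measurable:
  fixes f :: "real^'n \<Rightarrow> real^'m"
  shows "linear f \<Longrightarrow> f \<in> borel_measurable borel"
  by (intro borel_measurable_continuous_onI linear_continuous_on)
    (simp add: linear_conv_bounded_linear)

lemma distr_lborel_vec_reindex:
  fixes r :: "'b::finite \<Rightarrow> 'a::finite"
  assumes "bij r"
  shows "distr lborel borel (\<lambda>x::real^'a. \<chi> i. x $ r i) = (lborel :: (real^'b) measure)"
proof (rule lborel_eqI[symmetric])
  let ?\<phi> = "\<lambda>x::real^'a. \<chi> i. x $ r i"
  have "linear ?\<phi>"
    by (rule linearI) (simp_all add: vec_eq_iff)
  fix l u :: "real^'b"
  assume lu: "\<And>b. b \<in> Basis \<Longrightarrow> l \<bullet> b \<le> u \<bullet> b"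
  let ?l = "\<chi> j. l $ inv r j" and ?u = "\<chi> j. u $ inv r j"
  have "?\<phi> -` box l u = box ?l ?u"
    using assms by (auto simp: mem_box_cart bij_inv_eq_iff) (metis bij_inv_eq_iff)+
  moreover have "(\<Prod>j\<in>UNIV. u $ inv r j - l $ inv r j) = (\<Prod>i\<in>UNIV. u $ i - l $ i)"
    using prod.reindex_bij_betw[OF bij_betw_inv_into[OF assms], of "\<lambda>i. u $ i - l $ i"]
    by simp
  moreover have "l $ i \<le> u $ i" for i
    using lu[of "axis i 1"] by (simp add: inner_axis)
  then have "\<forall>b\<in>Basis. ?l \<bullet> b \<le> ?u \<bullet> b"
    by (auto simp: Basis_vec_def inner_axis)
  ultimately show "emeasure (distr lborel borel ?\<phi>) (box l u) = (\<Prod>b\<in>Basis. (u - l) \<bullet> b)"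
    using linear_borel_measurable[OF \<open>linear ?\<phi>\<close>]
    by (simp add: emeasure_distr emeasure_lborel_box_eq prod_Basis_vec inner_axis
        mem_box_cart prod_nonneg)
qed simp

(* HOL-Analysis proves that orthogonal maps preserve Lebesgue measure only for index types of
   class wellorder.  An arbitrary finite index type is transported to a copy of itself, ordered
   through an injection into nat. *)
typedef 'a ordered_copy = "UNIV :: 'a set" ..

instance ordered_copy :: (finite) finite
proof
  have "UNIV = range (Abs_ordered_copy :: 'a \<Rightarrow> 'a ordered_copy)"
    by (metis Abs_ordered_copy_cases UNIV_I rangeI subsetI subset_antisym)
  then show "finite (UNIV :: 'a ordered_copy set)"
    by (metis finite finite_imageI)
qed

instantiation ordered_copy :: (finite) wellorder
begin

definition copy_rank :: "'a ordered_copy \<Rightarrow> nat" where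
  "copy_rank x = to_nat_on (UNIV :: 'a set) (Rep_ordered_copy x)"

definition less_eq_ordered_copy :: "'a ordered_copy \<Rightarrow> 'a ordered_copy \<Rightarrow> bool" where
  "less_eq_ordered_copy x y \<longleftrightarrow> copy_rank x \<le> copy_rank y"

definition less_ordered_copy :: "'a ordered_copy \<Rightarrow> 'a ordered_copy \<Rightarrow> bool" where
  "less_ordered_copy x y \<longleftrightarrow> copy_rank x < copy_rank y"

lemma copy_rank_inject: "copy_rank x = copy_rank y \<Longrightarrow> x = y"
proof -
  have "inj_on (to_nat_on (UNIV :: 'a set)) UNIV"
    by (rule inj_on_to_nat_on) (simp add: countable_finite)
  then show "copy_rank x = copy_rank y \<Longrightarrow> x = y"
    unfolding copy_rank_def by (simp add: inj_on_eq_iff Rep_ordered_copy_inject)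
qed

instance
proof
  fix x y z :: "'a ordered_copy"
  show "x < y \<longleftrightarrow> x \<le> y \<and> \<not> y \<le> x"
    by (auto simp: less_eq_ordered_copy_def less_ordered_copy_def)
  show "x \<le> x"
    by (simp add: less_eq_ordered_copy_def)
  show "x \<le> y \<Longrightarrow> y \<le> z \<Longrightarrow> x \<le> z"
    by (simp add: less_eq_ordered_copy_def)
  show "x \<le> y \<Longrightarrow> y \<le> x \<Longrightarrow> x = y"
    by (simp add: less_eq_ordered_copy_def copy_rank_inject)
  show "x \<le> y \<or> y \<le> x"
    by (auto simp: less_eq_ordered_copy_def)
next
  fix P :: "'a ordered_copy \<Rightarrow> bool" and a
  assume step: "\<And>x. (\<And>y. y < x \<Longrightarrow> P y) \<Longrightarrow> P x"
  show "P a"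
  proof (induction a rule: measure_induct_rule[of copy_rank])
    case (less x)
    then show ?case
      by (rule step) (simp add: less_ordered_copy_def)
  qed
qed

end

lemma distr_lborel_orthogonal_transformation_wellorder:
  fixes f :: "real^'n::{finite,wellorder} \<Rightarrow> real^'n::_"
  assumes "orthogonal_transformation f"
  shows "distr lborel borel f = lborel"
proof (rule lborel_eqI[symmetric])
  fix l u :: "real^'n::{finite,wellorder}"
  define g where "g = inv f"
  have "orthogonal_transformation g" "bij f"
    using assms by (simp_all add: g_def orthogonal_transformation_inv orthogonal_transformation_bij)
  have "f -` box l u = g ` box l u"
    using \<open>bij f\<close> by (simp add: g_def bij_vimage_eq_inv_image)
  moreover have "open (g ` box l u)"
    using \<open>orthogonal_transformation g\<close>
    by (intro open_surjective_linear_image open_box orthogonal_transformation_linear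
        orthogonal_transformation_surj)
  ultimately have "emeasure (distr lborel borel f) (box l u) = emeasure lebesgue (g ` box l u)"
    using assms
    by (simp add: emeasure_distr linear_borel_measurable orthogonal_transformation_linear)
  also have "\<dots> = measure lebesgue (box l u)"
    using measure_orthogonal_image[OF \<open>orthogonal_transformation g\<close>, of "box l u"]
      measurable_orthogonal_image[OF \<open>orthogonal_transformation g\<close>, of "box l u"]
    by (simp add: emeasure_eq_measure2)
  also have "\<dots> = emeasure lborel (box l u)"
    by (simp add: emeasure_eq_measure2[symmetric])
  finally show "emeasure (distr lborel borel f) (box l u) = (\<Prod>b\<in>Basis. (u - l) \<bullet> b)"
    if "\<And>b. b \<in> Basis \<Longrightarrow> l \<bullet> b \<le> u \<bullet> b"
    using that by (simp add: emeasure_lborel_box_eq)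
qed simp

lemma bij_Rep_ordered_copy: "bij Rep_ordered_copy"
  unfolding bij_def
  by (auto intro!: injI surjI[of _ Abs_ordered_copy]
      simp: Rep_ordered_copy_inject Abs_ordered_copy_inverse)

lemma bij_Abs_ordered_copy: "bij Abs_ordered_copy"
  unfolding bij_def
  by (auto intro!: injI surjI[of _ Rep_ordered_copy]
      simp: Abs_ordered_copy_inject Rep_ordered_copy_inverse)

lemma distr_lborel_orthogonal_transformation:
  fixes f :: "real^'n \<Rightarrow> real^'n"
  assumes "orthogonal_transformation f"
  shows "distr lborel borel f = lborel"
proof -
  define \<phi> :: "real^'n \<Rightarrow> real^'n ordered_copy" where "\<phi> x = (\<chi> i. x $ Rep_ordered_copy i)" for x
  define \<psi> :: "real^'n ordered_copy \<Rightarrow> real^'n" where "\<psi> y = (\<chi> j. y $ Abs_ordered_copy j)" for y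
  define g where "g = \<phi> \<circ> f \<circ> \<psi>"
  have \<psi>\<phi>: "\<psi> (\<phi> x) = x" and \<phi>\<psi>: "\<phi> (\<psi> y) = y" for x y
    by (simp_all add: \<phi>_def \<psi>_def vec_eq_iff Abs_ordered_copy_inverse Rep_ordered_copy_inverse)
  have "linear \<phi>" "linear \<psi>"
    by (auto intro!: linearI simp: \<phi>_def \<psi>_def vec_eq_iff)
  have "\<phi> x \<bullet> \<phi> y = x \<bullet> y" for x y
    unfolding \<phi>_def inner_vec_def
    using sum.reindex_bij_betw[OF bij_Rep_ordered_copy, of "\<lambda>i. x $ i \<bullet> y $ i"] by simp
  then have norm_\<phi>: "norm (\<phi> x) = norm x" for x
    by (simp add: norm_eq_sqrt_inner)
  have "orthogonal_transformation g"
    unfolding orthogonal_transformation g_def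
  proof (intro conjI allI)
    show "linear (\<phi> \<circ> f \<circ> \<psi>)"
      using \<open>linear \<phi>\<close> \<open>linear \<psi>\<close> assms
      by (intro linear_compose) (auto simp: orthogonal_transformation_linear)
    show "norm ((\<phi> \<circ> f \<circ> \<psi>) v) = norm v" for v
      using assms norm_\<phi>[of "\<psi> v"] by (simp add: norm_\<phi> orthogonal_transformation_norm \<phi>\<psi>)
  qed
  have meas: "\<phi> \<in> borel_measurable borel" "\<psi> \<in> borel_measurable borel" "g \<in> borel_measurable borel"
    using \<open>linear \<phi>\<close> \<open>linear \<psi>\<close> \<open>orthogonal_transformation g\<close>
    by (simp_all add: linear_borel_measurable orthogonal_transformation_linear)
  have lborel_\<phi>: "distr lborel borel \<phi> = lborel" and lborel_\<psi>: "distr lborel borel \<psi> = lborel"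
    unfolding \<phi>_def \<psi>_def
    by (simp_all add: distr_lborel_vec_reindex bij_Rep_ordered_copy bij_Abs_ordered_copy)
  have "f = \<psi> \<circ> g \<circ> \<phi>"
    by (simp add: g_def fun_eq_iff \<psi>\<phi>)
  then have "distr lborel borel f = distr (distr (distr lborel borel \<phi>) borel g) borel \<psi>"
    using meas by (simp add: distr_distr comp_assoc)
  also have "\<dots> = lborel"
    using distr_lborel_orthogonal_transformation_wellorder[OF \<open>orthogonal_transformation g\<close>]
    by (simp add: lborel_\<phi> lborel_\<psi>)
  finally show ?thesis .
qed

section \<open>Gaussian averages\<close>

lemma matrix_inv_eqI:
  fixes A B :: "real^'n^'n"
  assumes "A ** B = mat 1" "B ** A = mat 1"
  shows "matrix_inv A = B"
proof -
  obtain B' where B': "A ** B' = mat 1" "B' ** A = mat 1" and "matrix_inv A = B'"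
    using someI[of "\<lambda>B'. A ** B' = mat 1 \<and> B' ** A = mat 1" B] assms
    unfolding matrix_inv_def by blast
  have "B' = B' ** (A ** B)"
    using assms(1) by simp
  also have "\<dots> = B"
    using B' by (simp add: matrix_mul_assoc)
  finally show ?thesis
    using \<open>matrix_inv A = B'\<close> by simp
qed

lemma real_sqrt_prod: "sqrt (\<Prod>i\<in>A. f i) = (\<Prod>i\<in>A. sqrt (f i))"
  by (induction A rule: infinite_finite_induct) (simp_all add: real_sqrt_mult)

lemma gauss_density_spectral:
  fixes Q :: "real^'n^'n"
  assumes "orthogonal_matrix Q" "\<And>i. 0 < d i"
  shows "gauss_density m (Q ** diag_mat d ** transpose Q) (m + Q *v z)
           = (\<Prod>i\<in>UNIV. normal_density 0 (sqrt (d i)) (z $ i))"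
proof -
  have QQ: "transpose Q ** Q = mat 1" "Q ** transpose Q = mat 1"
    using assms(1) by (simp_all add: orthogonal_matrix_def)
  define Si where "Si = Q ** diag_mat (\<lambda>i. 1 / d i) ** transpose Q"
  have "d i * (1 / d i) = 1" "1 / d i * d i = 1" for i
    using assms(2)[of i] by simp_all
  then have "(Q ** diag_mat d ** transpose Q) ** Si = mat 1"
    "Si ** (Q ** diag_mat d ** transpose Q) = mat 1"
    unfolding Si_def orthogonal_diag_mat_mult[OF assms(1)] using QQ by (simp_all add: diag_mat_one)
  then have inv: "matrix_inv (Q ** diag_mat d ** transpose Q) = Si"
    by (rule matrix_inv_eqI)
  have "transpose Q *v (Q *v z) = z"
    using QQ by (simp add: matrix_vector_mul_assoc)
  then have quad: "(Q *v z) \<bullet> (Si *v (Q *v z)) = (\<Sum>i\<in>UNIV. (z $ i)^2 / d i)"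
    unfolding Si_def quadratic_form_spectral by simp
  have "det Q * det Q = 1"
    using det_orthogonal_matrix[OF assms(1)] by auto
  then have det: "det (Q ** diag_mat d ** transpose Q) = (\<Prod>i\<in>UNIV. d i)"
    by (simp add: det_mul det_diagonal diag_mat_def)
  have "(2 * pi) ^ CARD('n) * (\<Prod>i\<in>UNIV. d i) = (\<Prod>i\<in>UNIV. 2 * pi * d i)"
    by (simp add: prod.distrib power_mult_distrib)
  then have "sqrt ((2 * pi) ^ CARD('n) * (\<Prod>i\<in>UNIV. d i)) = (\<Prod>i\<in>UNIV. sqrt (2 * pi * d i))"
    by (simp only: real_sqrt_prod)
  moreover have "exp (- (\<Sum>i\<in>UNIV. (z $ i)^2 / d i) / 2)
      = (\<Prod>i\<in>UNIV. exp (- ((z $ i)^2) / (2 * d i)))"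
    by (simp add: exp_sum[symmetric] sum_divide_distrib[symmetric] sum_negf sum_distrib_right)
  ultimately show ?thesis
    using assms(2)
    by (simp add: gauss_density_def normal_density_def inv quad det prod.distrib prod_dividef
        less_imp_le)
qed

lemma gauss_density_nonneg:
  fixes Sig :: "real^'n^'n"
  assumes "pd Sig"
  shows "0 \<le> gauss_density m Sig x"
proof -
  obtain Q d where Q: "orthogonal_matrix Q" "Sig = Q ** diag_mat d ** transpose Q" "\<And>i. 0 < d i"
    using pd_spectral_decomposition[OF assms] by blast
  define z where "z = transpose Q *v (x - m)"
  have "Q *v z = x - m"
    using Q(1) unfolding z_def matrix_vector_mul_assoc by (simp add: orthogonal_matrix_def)
  then have "x = m + Q *v z"
    by simp
  then have "gauss_density m Sig x = (\<Prod>i\<in>UNIV. normal_density 0 (sqrt (d i)) (z $ i))"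
    using gauss_density_spectral[OF Q(1,3)] Q(2) by simp
  also have "\<dots> \<ge> 0"
    by (simp add: prod_nonneg)
  finally show ?thesis .
qed

lemma nn_integral_normal_density:
  "0 < \<sigma> \<Longrightarrow> (\<integral>\<^sup>+x. ennreal (normal_density \<mu> \<sigma> x) \<partial>lborel) = 1"
proof -
  assume "0 < \<sigma>"
  then have "(\<integral>\<^sup>+x. ennreal (normal_density \<mu> \<sigma> x) \<partial>lborel)
      = ennreal (\<integral>x. normal_density \<mu> \<sigma> x \<partial>lborel)"
    by (intro nn_integral_eq_integral) auto
  then show ?thesis
    using \<open>0 < \<sigma>\<close> by simp
qed

lemma continuous_gauss_density: "continuous_on UNIV (gauss_density m Sig)"
  unfolding gauss_density_def divide_inverse[of "exp _"]
  by (intro continuous_intros continuous_on_compose2[OF matrix_vector_mult_linear_continuous_on])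
    auto

lemma has_integral_gauss_density:
  fixes Sig :: "real^'n^'n"
  assumes "pd Sig"
  shows "(gauss_density m Sig has_integral 1) UNIV"
proof -
  obtain Q d where Q: "orthogonal_matrix Q" "Sig = Q ** diag_mat d ** transpose Q"
    and d: "\<And>i. 0 < d i"
    using pd_spectral_decomposition[OF assms] by blast
  have "orthogonal_transformation ((*v) Q)"
    using Q(1) by (simp add: orthogonal_transformation_matrix)
  then have "distr lborel borel (\<lambda>z. m + Q *v z)
      = distr (distr lborel borel ((*v) Q)) borel ((+) m)"
    by (simp add: distr_distr linear_borel_measurable orthogonal_transformation_linear comp_def)
  then have lborel_affine_map: "distr lborel borel (\<lambda>z. m + Q *v z) = lborel"
    by (simp add: distr_lborel_orthogonal_transformation[OF \<open>orthogonal_transformation ((*v) Q)\<close>]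
        lborel_distr_plus)
  define g where "g b = normal_density 0 (sqrt (d (axis_index b)))" for b :: "real^'n"
  have density: "gauss_density m Sig (m + Q *v z) = (\<Prod>b\<in>Basis. g b (z \<bullet> b))" for z
    by (simp add: g_def Q(2) gauss_density_spectral[OF Q(1) d] prod_Basis_vec inner_axis)
  have [measurable]: "gauss_density m Sig \<in> borel_measurable borel"
    by (rule borel_measurable_continuous_onI[OF continuous_gauss_density])
  have [measurable]: "(\<lambda>z. m + Q *v z) \<in> borel_measurable borel"
    using linear_borel_measurable[OF matrix_vector_mul_linear[of Q]] by measurable
  have "(\<integral>\<^sup>+x. gauss_density m Sig x \<partial>lborel) = (\<integral>\<^sup>+z. gauss_density m Sig (m + Q *v z) \<partial>lborel)"
    by (subst lborel_affine_map[symmetric]) (rule nn_integral_distr; measurable)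
  also have "\<dots> = (\<integral>\<^sup>+z. (\<Prod>b\<in>Basis. ennreal (g b (z \<bullet> b))) \<partial>lborel)"
    by (rule nn_integral_cong) (simp add: density g_def prod_ennreal)
  also have "\<dots> = 1"
    by (subst nn_integral_lborel_prod) (simp_all add: g_def d nn_integral_normal_density)
  finally show ?thesis
    using gauss_density_nonneg[OF assms] by (intro nn_integral_has_integral) auto
qed

lemma bounded_linear_transpose: "bounded_linear (transpose :: real^'n^'m \<Rightarrow> real^'m^'n)"
  unfolding linear_conv_bounded_linear[symmetric]
  by (rule linearI) (simp_all add: vec_eq_iff transpose_def)

lemma bounded_linear_quadratic_form: "bounded_linear (\<lambda>M :: real^'n^'n. v \<bullet> (M *v v))"
  unfolding linear_conv_bounded_linear[symmetric]
  by (rule linearI) (simp_all add: matrix_vector_mult_add_rdistrib inner_add_right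
      scaleR_matrix_vector_assoc[symmetric])

lemma psd_integral:
  fixes P :: "'a::euclidean_space \<Rightarrow> real^'n^'n"
  assumes "\<And>x. psd (P x)" "\<And>x. 0 \<le> d x"
  shows "psd (integral S (\<lambda>x. d x *\<^sub>R P x))"
proof (cases "(\<lambda>x. d x *\<^sub>R P x) integrable_on S")
  case True
  have "transpose (integral S (\<lambda>x. d x *\<^sub>R P x)) = integral S (\<lambda>x. transpose (d x *\<^sub>R P x))"
    using integral_linear[OF True bounded_linear_transpose] by (simp add: o_def)
  also have "\<dots> = integral S (\<lambda>x. d x *\<^sub>R P x)"
    using assms(1) by (simp add: transpose_scalar psd_def sym_mat_def)
  finally have "sym_mat (integral S (\<lambda>x. d x *\<^sub>R P x))"
    by (simp add: sym_mat_def)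
  moreover have "0 \<le> v \<bullet> (integral S (\<lambda>x. d x *\<^sub>R P x) *v v)" for v
  proof -
    have "v \<bullet> (integral S (\<lambda>x. d x *\<^sub>R P x) *v v) = integral S (\<lambda>x. v \<bullet> ((d x *\<^sub>R P x) *v v))"
      using integral_linear[OF True bounded_linear_quadratic_form] by (simp add: o_def)
    also have "\<dots> \<ge> 0"
      using integrable_linear[OF True bounded_linear_quadratic_form] assms
      by (intro integral_nonneg) (auto simp: o_def psd_def scaleR_matrix_vector_assoc[symmetric])
    finally show ?thesis .
  qed
  ultimately show ?thesis
    by (simp add: psd_def)
next
  case False
  then show ?thesis
    by (simp add: not_integrable_integral psd_def sym_mat_def transpose_def vec_eq_iff)
qed

lemma loewner_le_average:
  fixes H :: "'a::euclidean_space \<Rightarrow> real^'n^'n"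
  assumes "(d has_integral 1) UNIV" "\<And>x. 0 \<le> d x" "\<And>x. loewner_le (H x) B" "psd B"
  shows "loewner_le (integral UNIV (\<lambda>x. d x *\<^sub>R H x)) B"
  \<comment> \<open>\<open>psd B\<close> covers the case where the average does not exist and \<open>integral\<close> returns 0.\<close>
proof (cases "(\<lambda>x. d x *\<^sub>R H x) integrable_on UNIV")
  case True
  have "((\<lambda>x. d x *\<^sub>R B) has_integral B) UNIV"
    using has_integral_scaleR_left[OF assms(1)] by simp
  then have "B - integral UNIV (\<lambda>x. d x *\<^sub>R H x) = integral UNIV (\<lambda>x. d x *\<^sub>R (B - H x))"
    using True by (simp add: scaleR_diff_right integral_diff has_integral_iff)
  also have "psd \<dots>"
    using assms(2,3) by (intro psd_integral) (simp add: loewner_le_def)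
  finally show ?thesis
    by (simp add: loewner_le_def)
qed (use assms(4) in \<open>simp add: loewner_le_def not_integrable_integral\<close>)

lemma gauss_expect_loewner_le:
  fixes H :: "real^'n \<Rightarrow> real^'n^'n"
  assumes "pd Sig" "\<And>x. loewner_le (H x) B" "psd B"
  shows "loewner_le (gauss_expect m Sig H) B"
  unfolding gauss_expect_def
  using assms has_integral_gauss_density gauss_density_nonneg by (intro loewner_le_average) auto

section \<open>One step of the iteration\<close>

lemma quadratic_root_lower_bound:
  fixes \<beta> \<eta> \<rho> s :: real
  assumes "\<beta> > 0" "\<eta> * \<beta> \<le> 1" "s \<le> \<rho>" "\<rho>^2 - 2 * \<rho> * s = 4 * \<eta> * s"
    and "(1 - \<eta> * \<beta>)^2 \<le> \<beta> * s"
  shows "2 - 2 * \<eta> * \<beta> \<le> \<beta> * \<rho>"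
proof (rule ccontr)
  define t where "t = 2 - 2 * \<eta> * \<beta>"
  assume "\<not> ?thesis"
  then have "\<beta> * \<rho> < t" by (simp add: t_def)
  moreover have "\<beta> * s \<le> \<beta> * \<rho>" using assms(1,3) by simp
  ultimately have "(t - \<beta> * \<rho>) * (t + \<beta> * \<rho> - 2 * (\<beta> * s)) > 0"
    by (intro mult_pos_pos) auto
  moreover have "\<beta>^2 * (\<rho>^2 - 2 * \<rho> * s) = \<beta>^2 * (4 * \<eta> * s)"
    using assms(4) by simp
  ultimately have "t^2 > 4 * (\<beta> * s)"
    by (simp add: t_def algebra_simps power2_eq_square)
  moreover have "t^2 = 4 * (1 - \<eta> * \<beta>)^2"
    by (simp add: t_def power2_eq_square algebra_simps)
  ultimately show False
    using assms(5) by simp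
qed

lemma forward_step_lower_bound:
  fixes S Sig :: "real^'n^'n"
  assumes "\<beta> > 0" "0 \<le> \<eta>" "\<eta> * \<beta> \<le> 1"
    and "loewner_le S (\<beta> *\<^sub>R mat 1)" "loewner_le ((1 / \<beta>) *\<^sub>R mat 1) Sig"
  shows "loewner_le (((1 - \<eta> * \<beta>)^2 / \<beta>) *\<^sub>R mat 1)
           ((mat 1 - \<eta> *\<^sub>R S) ** Sig ** (mat 1 - \<eta> *\<^sub>R S))"
proof -
  define T where "T = mat 1 - \<eta> *\<^sub>R S"
  have symS: "sym_mat S" and S_le: "\<And>x. x \<bullet> (S *v x) \<le> \<beta> * (x \<bullet> x)"
    using assms(4) by (auto simp: loewner_le_scaled_id_iff)
  have symSig: "sym_mat Sig" and Sig_ge: "\<And>x. (1 / \<beta>) * (x \<bullet> x) \<le> x \<bullet> (Sig *v x)"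
    using assms(5) by (auto simp: scaled_id_loewner_le_iff)
  have Tx: "T *v x = x - \<eta> *\<^sub>R (S *v x)" for x
    by (simp add: T_def matrix_vector_mult_simps)
  have symT: "x \<bullet> (T *v y) = (T *v x) \<bullet> y" for x y
    using sym_mat_inner[OF symS, of x y] by (simp add: Tx inner_diff_right inner_diff_left)
  have TST: "(T ** Sig ** T) *v x = T *v (Sig *v (T *v x))" for x
    by (simp add: matrix_vector_mul_assoc matrix_mul_assoc)
  have "sym_mat (T ** Sig ** T)"
    unfolding sym_mat_iff_inner TST by (simp add: symT sym_mat_inner[OF symSig])
  moreover have "(1 - \<eta> * \<beta>)^2 / \<beta> * (x \<bullet> x) \<le> x \<bullet> ((T ** Sig ** T) *v x)" for x
  proof (cases "x = 0")
    case False
    have "\<eta> * (x \<bullet> (S *v x)) \<le> \<eta> * (\<beta> * (x \<bullet> x))"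
      using S_le[of x] assms(2) by (rule mult_left_mono)
    then have "(1 - \<eta> * \<beta>) * (x \<bullet> x) \<le> x \<bullet> (T *v x)"
      by (simp add: Tx inner_diff_right algebra_simps)
    moreover have "0 \<le> (1 - \<eta> * \<beta>) * (x \<bullet> x)"
      using assms(3) by simp
    ultimately have "((1 - \<eta> * \<beta>) * (x \<bullet> x))^2 \<le> (x \<bullet> (T *v x))^2"
      by (rule power_mono)
    also have "\<dots> \<le> (x \<bullet> x) * ((T *v x) \<bullet> (T *v x))"
      using Cauchy_Schwarz_ineq[of x "T *v x"] .
    finally have "(1 - \<eta> * \<beta>)^2 * (x \<bullet> x) \<le> (T *v x) \<bullet> (T *v x)"
      using False by (simp add: power2_eq_square mult_ac)
    also have "\<dots> \<le> \<beta> * ((T *v x) \<bullet> (Sig *v (T *v x)))"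
      using Sig_ge[of "T *v x"] assms(1) by (simp add: field_simps)
    finally show ?thesis
      using assms(1) by (simp add: TST symT field_simps)
  qed simp
  ultimately show ?thesis
    unfolding T_def[symmetric] by (simp add: scaled_id_loewner_le_iff)
qed

lemma backward_step_eigenvalue_bound:
  fixes Sh R :: "real^'n^'n"
  assumes "\<beta> > 0" "\<eta> * \<beta> \<le> 1" "loewner_le (((1 - \<eta> * \<beta>)^2 / \<beta>) *\<^sub>R mat 1) Sh"
    and "psd R" "R ** R = Sh ** (Sh + (4 * \<eta>) *\<^sub>R mat 1)"
    and "norm u = 1" "((1/2) *\<^sub>R (Sh + (2 * \<eta>) *\<^sub>R mat 1 + R)) *v u = \<sigma> *\<^sub>R u"
  shows "1 / \<beta> \<le> \<sigma>"
proof -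
  have symSh: "x \<bullet> (Sh *v y) = (Sh *v x) \<bullet> y" for x y
    using assms(3) by (simp add: scaled_id_loewner_le_iff sym_mat_inner)
  have symR: "x \<bullet> (R *v y) = (R *v x) \<bullet> y" and R_pos: "0 \<le> x \<bullet> (R *v x)" for x y
    using assms(4) by (auto simp: psd_def sym_mat_inner)
  have uu: "u \<bullet> u = 1"
    using assms(6) by (simp add: dot_square_norm)
  define \<rho> where "\<rho> = 2 * \<sigma> - 2 * \<eta>"
  define s where "s = u \<bullet> (Sh *v u)"
  have "Sh *v u + (2 * \<eta>) *\<^sub>R u + R *v u = 2 *\<^sub>R (((1/2) *\<^sub>R (Sh + (2 * \<eta>) *\<^sub>R mat 1 + R)) *v u)"
    by (simp add: matrix_vector_mult_simps)
  then have Ru: "R *v u = \<rho> *\<^sub>R u - Sh *v u"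
    unfolding assms(7) by (simp add: \<rho>_def algebra_simps)
  have "s \<le> \<rho>"
    using R_pos[of u] by (simp add: Ru inner_diff_right uu s_def)
  have "(R *v u) \<bullet> (R *v u) = u \<bullet> ((Sh ** (Sh + (4 * \<eta>) *\<^sub>R mat 1)) *v u)"
    using symR[of u "R *v u"] assms(5) by (simp add: matrix_vector_mul_assoc)
  also have "\<dots> = (Sh *v u) \<bullet> (Sh *v u) + 4 * \<eta> * s"
    by (simp add: matrix_vector_mult_simps inner_add_right symSh s_def)
  finally have "\<rho>^2 - 2 * \<rho> * s = 4 * \<eta> * s"
    by (simp add: Ru inner_diff_right inner_diff_left uu s_def inner_commute power2_eq_square
        algebra_simps)
  moreover have "(1 - \<eta> * \<beta>)^2 / \<beta> * (u \<bullet> u) \<le> u \<bullet> (Sh *v u)"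
    using assms(3) by (simp add: scaled_id_loewner_le_iff)
  then have "(1 - \<eta> * \<beta>)^2 \<le> \<beta> * s"
    using assms(1) uu by (simp add: s_def field_simps)
  ultimately have "2 - 2 * \<eta> * \<beta> \<le> \<beta> * \<rho>"
    using quadratic_root_lower_bound assms(1,2) \<open>s \<le> \<rho>\<close> by blast
  then show ?thesis
    using assms(1) by (simp add: \<rho>_def field_simps)
qed

lemma backward_step_lower_bound:
  fixes Sh :: "real^'n^'n"
  assumes "\<beta> > 0" "0 < \<eta>" "\<eta> * \<beta> \<le> 1"
    and "loewner_le (((1 - \<eta> * \<beta>)^2 / \<beta>) *\<^sub>R mat 1) Sh"
  shows "loewner_le ((1 / \<beta>) *\<^sub>R mat 1)
           ((1/2) *\<^sub>R (Sh + (2 * \<eta>) *\<^sub>R mat 1 + psd_sqrt (Sh ** (Sh + (4 * \<eta>) *\<^sub>R mat 1))))"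
    (is "loewner_le _ ?Sig")
proof -
  have "psd Sh"
    using assms(1,4) by (intro psd_if_scaled_id_loewner_le) auto
  define R where "R = psd_sqrt (Sh ** (Sh + (4 * \<eta>) *\<^sub>R mat 1))"
  have "psd R" "R ** R = Sh ** (Sh + (4 * \<eta>) *\<^sub>R mat 1)"
    using psd_sqrt[OF psd_mult_add_scaled_id[OF \<open>psd Sh\<close>]] assms(2) by (simp_all add: R_def)
  have "sym_mat ?Sig"
    using \<open>psd Sh\<close> \<open>psd R\<close>
    by (simp add: R_def[symmetric] psd_def sym_mat_add sym_mat_scaleR sym_mat_scaled_id)
  have "psd (?Sig - (1 / \<beta>) *\<^sub>R mat 1)"
  proof (rule psd_if_eigenvalues_nonneg)
    show "sym_mat (?Sig - (1 / \<beta>) *\<^sub>R mat 1)"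
      using \<open>sym_mat ?Sig\<close> by (simp add: sym_mat_diff sym_mat_scaled_id)
    fix v l assume "v \<noteq> 0" "(?Sig - (1 / \<beta>) *\<^sub>R mat 1) *v v = l *\<^sub>R v"
    then have "?Sig *v (v /\<^sub>R norm v) = (l + 1 / \<beta>) *\<^sub>R (v /\<^sub>R norm v)"
      by (simp add: matrix_vector_mult_simps algebra_simps)
    then have "1 / \<beta> \<le> l + 1 / \<beta>"
      using backward_step_eigenvalue_bound[OF assms(1,3,4) \<open>psd R\<close> \<open>R ** R = _\<close>, of "v /\<^sub>R norm v"]
        \<open>v \<noteq> 0\<close> by (simp add: R_def)
    then show "0 \<le> l" by simp
  qed
  then show ?thesis
    by (simp add: loewner_le_def)
qed

lemma gvi_step_lower_bound:
  fixes S Sig :: "real^'n^'n"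
  assumes "\<beta> > 0" "0 < \<eta>" "\<eta> \<le> 1 / \<beta>"
    and "loewner_le S (\<beta> *\<^sub>R mat 1)" "loewner_le ((1 / \<beta>) *\<^sub>R mat 1) Sig"
  shows "loewner_le ((1 / \<beta>) *\<^sub>R mat 1) (snd (gvi_step \<eta> b S m Sig))"
proof -
  have "\<eta> * \<beta> \<le> 1"
    using assms(1,3) by (simp add: field_simps)
  have "loewner_le (((1 - \<eta> * \<beta>)^2 / \<beta>) *\<^sub>R mat 1)
          ((mat 1 - \<eta> *\<^sub>R S) ** Sig ** (mat 1 - \<eta> *\<^sub>R S))"
    using assms(1,2,4,5) \<open>\<eta> * \<beta> \<le> 1\<close> by (intro forward_step_lower_bound) auto
  then show ?thesis
    using backward_step_lower_bound[OF assms(1,2) \<open>\<eta> * \<beta> \<le> 1\<close>]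
    by (simp add: gvi_step_def Let_def)
qed

theorem mainTheorem15:
  fixes V :: "real^'n \<Rightarrow> real" and gradV :: "real^'n \<Rightarrow> real^'n"
    and H :: "real^'n \<Rightarrow> real^'n^'n"
    and \<beta> \<eta> :: real and m0 :: "real^'n" and Sig0 :: "real^'n^'n"
  assumes gradV: "\<And>x. (V has_derivative (\<lambda>h. gradV x \<bullet> h)) (at x)"
    and hess: "\<And>x. (gradV has_derivative (\<lambda>h. H x *v h)) (at x)"
    and hess_cont: "continuous_on UNIV H"
    and hess_bounds: "\<And>x. loewner_le ((- \<beta>) *\<^sub>R mat 1) (H x) \<and> loewner_le (H x) (\<beta> *\<^sub>R mat 1)"
    and beta_pos: "\<beta> > 0"
    and eta: "0 < \<eta>" "\<eta> \<le> 1 / \<beta>"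
    and Sig0_pd: "pd Sig0"
    and Sig0_ge: "loewner_le ((1 / \<beta>) *\<^sub>R mat 1) Sig0"
  shows "(\<forall>k. loewner_le ((1 / \<beta>) *\<^sub>R mat 1) (snd (fbgvi gradV H \<eta> m0 Sig0 k)))
       \<and> (\<forall>X k. loewner_le ((1 / \<beta>) *\<^sub>R mat 1) (snd (sfbgvi gradV H \<eta> m0 Sig0 X k)))"
proof -
  have H_le: "loewner_le (H x) (\<beta> *\<^sub>R mat 1)" for x
    using hess_bounds by blast
  note step = gvi_step_lower_bound[OF beta_pos eta]
  have "loewner_le ((1 / \<beta>) *\<^sub>R mat 1) (snd (fbgvi gradV H \<eta> m0 Sig0 k))" for k
  proof (induction k)
    case (Suc k)
    obtain m Sig where mSig: "fbgvi gradV H \<eta> m0 Sig0 k = (m, Sig)"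
      by fastforce
    have "pd Sig"
      using Suc.IH beta_pos by (intro pd_if_scaled_id_loewner_le[of "1 / \<beta>"]) (simp_all add: mSig)
    then have "loewner_le (gauss_expect m Sig H) (\<beta> *\<^sub>R mat 1)"
      using H_le beta_pos by (simp add: gauss_expect_loewner_le psd_scaled_id)
    then show ?case
      using step Suc.IH by (simp add: mSig)
  qed (simp add: Sig0_ge)
  moreover have "loewner_le ((1 / \<beta>) *\<^sub>R mat 1) (snd (sfbgvi gradV H \<eta> m0 Sig0 X k))" for X k
  proof (induction k)
    case (Suc k)
    obtain m Sig where mSig: "sfbgvi gradV H \<eta> m0 Sig0 X k = (m, Sig)"
      by fastforce
    have "loewner_le ((1 / \<beta>) *\<^sub>R mat 1) Sig"
      using Suc.IH by (simp add: mSig)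
    then show ?case
      by (simp add: mSig step H_le)
  qed (simp add: Sig0_ge)
  ultimately show ?thesis
    by blast
qed

end
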